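(* Consider the generalized ARCH model $$X_t=\sigma_t\epsilon_t,\qquad \sigma_t^2=\alpha_0+\alpha_1X_{t-1}^2+l_1L_{t-1},\qquad t\in\mathbb{Z},$$ with $\alpha_0\ge 0$, $\alpha_1,l_1>0$. Assume that $\mathbb{E}(L_0^2)<\infty$ and $\alpha_1<1$. Then the model has the following (well-defined, almost surely finite) strictly stationary solution: $$\sigma_{t+1}^2=\sum_{i=0}^\infty\left(\prod_{j=0}^{i-1}A_{t-j}\right)B_{t-i},\qquad t\in\mathbb{Z},$$ where $A_t=\alpha_1\epsilon_t^2$ and $B_t=\alpha_0+l_1L_t$.
   Context: Standing assumptions on the model: $(\epsilon_t)_{t\in\mathbb{Z}}$ is an i.i.d. process with $\mathbb{E}(\epsilon_0)=0$ and $\mathbb{E}(\epsilon_0^2)=1$; $(L_t)_{t\in\mathbb{Z}}$ (the liquidity) is a strictly stationary positive process with $\mathbb{E}(L_0)=1$, independent of $(\epsilon_t)_{t\in\mathbb{Z}}$. The empty product is $1$. Since $X_{t}^2=\sigma_t^2\epsilon_t^2$, being a solution means that the nonnegative process $(\sigma_t^2)_{t\in\mathbb{Z}}$ satisfies $\sigma_{t+1}^2=A_t\sigma_t^2+B_t$ almost surely for every $t\in\mathbb{Z}$ (with $X_t=\sigma_t\epsilon_t$). Strict stationarity means that the finite-dimensional distributions of $(\sigma_t^2)_{t\in\mathbb{Z}}$ are invariant under time shifts. *)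

theory Defs
  imports "HOL-Probability.Probability"
begin

definition iid_process :: "'a measure \<Rightarrow> (int \<Rightarrow> 'a \<Rightarrow> real) \<Rightarrow> bool" where
  "iid_process M Y \<longleftrightarrow>
     prob_space.indep_vars M (\<lambda>_. borel) Y UNIV \<and>
     (\<forall>t. distr M borel (Y t) = distr M borel (Y 0))"

text \<open>Measurability is part of the definition because \<^const>\<open>distr\<close> is only the law of its
  argument when that argument is measurable.\<close>

definition strictly_stationary :: "'a measure \<Rightarrow> (int \<Rightarrow> 'a \<Rightarrow> real) \<Rightarrow> bool" where
  "strictly_stationary M Y \<longleftrightarrow>
     (\<forall>t. Y t \<in> borel_measurable M) \<and>
     (\<forall>J h. finite J \<longrightarrow>
        distr M (\<Pi>\<^sub>M t\<in>J. borel) (\<lambda>\<omega>. \<lambda>t\<in>J. Y (t + h) \<omega>) =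
        distr M (\<Pi>\<^sub>M t\<in>J. borel) (\<lambda>\<omega>. \<lambda>t\<in>J. Y t \<omega>))"

text \<open>Independence of whole processes, seen as random elements of the product space
  over all of \<open>int\<close>.\<close>

definition independent_processes ::
    "'a measure \<Rightarrow> (int \<Rightarrow> 'a \<Rightarrow> real) \<Rightarrow> (int \<Rightarrow> 'a \<Rightarrow> real) \<Rightarrow> bool" where
  "independent_processes M Y Z \<longleftrightarrow>
     prob_space.indep_var M
       (\<Pi>\<^sub>M t\<in>UNIV. borel) (\<lambda>\<omega> t. Y t \<omega>)
       (\<Pi>\<^sub>M t\<in>UNIV. borel) (\<lambda>\<omega> t. Z t \<omega>)"

definition arch_A :: "real \<Rightarrow> (int \<Rightarrow> 'a \<Rightarrow> real) \<Rightarrow> int \<Rightarrow> 'a \<Rightarrow> real" where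
  "arch_A \<alpha>1 \<epsilon> t \<omega> = \<alpha>1 * (\<epsilon> t \<omega>)\<^sup>2"

definition arch_B :: "real \<Rightarrow> real \<Rightarrow> (int \<Rightarrow> 'a \<Rightarrow> real) \<Rightarrow> int \<Rightarrow> 'a \<Rightarrow> real" where
  "arch_B \<alpha>0 l1 L t \<omega> = \<alpha>0 + l1 * L t \<omega>"

definition arch_term ::
    "real \<Rightarrow> real \<Rightarrow> real \<Rightarrow> (int \<Rightarrow> 'a \<Rightarrow> real) \<Rightarrow> (int \<Rightarrow> 'a \<Rightarrow> real) \<Rightarrow> int \<Rightarrow> 'a \<Rightarrow> nat \<Rightarrow> real" where
  "arch_term \<alpha>0 \<alpha>1 l1 \<epsilon> L t \<omega> i =
     (\<Prod>j<i. arch_A \<alpha>1 \<epsilon> (t - int j) \<omega>) * arch_B \<alpha>0 l1 L (t - int i) \<omega>"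

text \<open>The equations of the model for the pair of processes \<open>X\<close>, \<open>\<sigma>\<close>, each holding almost surely.\<close>

definition arch_model_solution ::
    "'a measure \<Rightarrow> real \<Rightarrow> real \<Rightarrow> real \<Rightarrow> (int \<Rightarrow> 'a \<Rightarrow> real) \<Rightarrow> (int \<Rightarrow> 'a \<Rightarrow> real) \<Rightarrow>
     (int \<Rightarrow> 'a \<Rightarrow> real) \<Rightarrow> (int \<Rightarrow> 'a \<Rightarrow> real) \<Rightarrow> bool" where
  "arch_model_solution M \<alpha>0 \<alpha>1 l1 \<epsilon> L X \<sigma> \<longleftrightarrow>
     (\<forall>t. X t \<in> borel_measurable M \<and> \<sigma> t \<in> borel_measurable M \<and>
          (AE \<omega> in M. 0 \<le> \<sigma> t \<omega>) \<and>
          (AE \<omega> in M. X t \<omega> = \<sigma> t \<omega> * \<epsilon> t \<omega>) \<and>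
          (AE \<omega> in M. (\<sigma> t \<omega>)\<^sup>2 = \<alpha>0 + \<alpha>1 * (X (t - 1) \<omega>)\<^sup>2 + l1 * L (t - 1) \<omega>))"

text \<open>The same model as a stochastic recurrence; \<open>V t\<close> plays the role of the squared
  volatility \<open>\<sigma>\<^sub>t\<^sup>2\<close>.\<close>

definition arch_recurrence_solution ::
    "'a measure \<Rightarrow> real \<Rightarrow> real \<Rightarrow> real \<Rightarrow> (int \<Rightarrow> 'a \<Rightarrow> real) \<Rightarrow> (int \<Rightarrow> 'a \<Rightarrow> real) \<Rightarrow>
     (int \<Rightarrow> 'a \<Rightarrow> real) \<Rightarrow> bool" where
  "arch_recurrence_solution M \<alpha>0 \<alpha>1 l1 \<epsilon> L V \<longleftrightarrow>
     (\<forall>t. V t \<in> borel_measurable M \<and>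
          (AE \<omega> in M. 0 \<le> V t \<omega>) \<and>
          (AE \<omega> in M. V (t + 1) \<omega> = arch_A \<alpha>1 \<epsilon> t \<omega> * V t \<omega> + arch_B \<alpha>0 l1 L t \<omega>))"

end

theory Submission
  imports Defs
begin

text \<open>The \<open>i\<close>-th summand has expectation \<open>\<alpha>1\<^sup>i * (\<alpha>0 + l1)\<close> because its factors are independent, so
  the expectation of the nonnegative series is a convergent geometric series and the series is
  almost surely finite. The sum is a measurable functional of the path of \<open>(L, \<epsilon>)\<close> commuting with
  time shifts, and the law of that path is shift invariant.\<close>

section \<open>Algebra of the summands and the recurrence\<close>

lemma arch_term_0: "arch_term \<alpha>0 \<alpha>1 l1 \<epsilon> L t \<omega> 0 = arch_B \<alpha>0 l1 L t \<omega>"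
  by (simp add: arch_term_def)

text \<open>Peeling off the factor \<open>j = 0\<close> leaves a product that starts at
  \<open>t - 1\<close>. The rule \<open>prod.lessThan_Suc\<close> is disabled because it would peel
  off the last factor instead.\<close>

lemma arch_term_Suc:
  "arch_term \<alpha>0 \<alpha>1 l1 \<epsilon> L t \<omega> (Suc i) =
     arch_A \<alpha>1 \<epsilon> t \<omega> * arch_term \<alpha>0 \<alpha>1 l1 \<epsilon> L (t - 1) \<omega> i"
  by (simp add: arch_term_def prod.lessThan_Suc_shift mult.assoc diff_diff_eq del: prod.lessThan_Suc)

lemma arch_term_nonneg:
  assumes "0 \<le> \<alpha>0" "0 \<le> \<alpha>1" "0 \<le> l1" "\<And>t. 0 \<le> L t \<omega>"
  shows "0 \<le> arch_term \<alpha>0 \<alpha>1 l1 \<epsilon> L t \<omega> i"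
  using assms by (auto simp: arch_term_def arch_A_def arch_B_def intro!: mult_nonneg_nonneg prod_nonneg)

lemma measurable_arch_term:
  assumes [measurable]: "\<And>t. \<epsilon> t \<in> borel_measurable M" "\<And>t. L t \<in> borel_measurable M"
  shows "(\<lambda>\<omega>. arch_term \<alpha>0 \<alpha>1 l1 \<epsilon> L t \<omega> i) \<in> borel_measurable M"
  unfolding arch_term_def arch_A_def arch_B_def by measurable

text \<open>The head \<open>i = 0\<close> is the additive part of the recurrence; by
  \<open>arch_term_Suc\<close> the tail is the series at \<open>t - 1\<close> with a common factor
  pulled out.\<close>

lemma suminf_arch_term_rec:
  assumes "summable (arch_term \<alpha>0 \<alpha>1 l1 \<epsilon> L t \<omega>)"
    and "summable (arch_term \<alpha>0 \<alpha>1 l1 \<epsilon> L (t - 1) \<omega>)"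
  shows "(\<Sum>i. arch_term \<alpha>0 \<alpha>1 l1 \<epsilon> L t \<omega> i) =
    arch_A \<alpha>1 \<epsilon> t \<omega> * (\<Sum>i. arch_term \<alpha>0 \<alpha>1 l1 \<epsilon> L (t - 1) \<omega> i) + arch_B \<alpha>0 l1 L t \<omega>"
  using suminf_split_head[OF assms(1)] suminf_mult[OF assms(2), of "arch_A \<alpha>1 \<epsilon> t \<omega>"]
  by (simp add: arch_term_0 arch_term_Suc)

section \<open>Expectations: almost sure summability and equality in law\<close>

text \<open>Monotone convergence: the integral of the \<open>ennreal\<close>-valued sum is the sum
  of the integrals, hence finite, and a function with finite integral is finite almost
  everywhere.\<close>

lemma AE_summable_of_integral:
  fixes f :: "nat \<Rightarrow> 'a \<Rightarrow> real"
  assumes int: "\<And>i. integrable M (f i)"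
    and nonneg: "\<And>i. AE x in M. 0 \<le> f i x"
    and sum: "summable (\<lambda>i. \<integral>x. f i x \<partial>M)"
  shows "AE x in M. summable (\<lambda>i. f i x)"
proof -
  have [measurable]: "f i \<in> borel_measurable M" for i
    using int by auto
  have nn: "0 \<le> (\<integral>x. f i x \<partial>M)" for i
    using nonneg by (rule integral_nonneg_AE)
  have "(\<integral>\<^sup>+x. (\<Sum>i. ennreal (f i x)) \<partial>M) = (\<Sum>i. \<integral>\<^sup>+x. ennreal (f i x) \<partial>M)"
    by (intro nn_integral_suminf) measurable
  also have "\<dots> = (\<Sum>i. ennreal (\<integral>x. f i x \<partial>M))"
    by (intro suminf_cong nn_integral_eq_integral int nonneg)
  also have "\<dots> \<noteq> \<infinity>"
    using suminf_ennreal2[OF nn sum] by simp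
  finally have "AE x in M. (\<Sum>i. ennreal (f i x)) \<noteq> \<infinity>"
    by (intro nn_integral_noteq_infinite) measurable
  moreover have "AE x in M. \<forall>i. 0 \<le> f i x"
    using nonneg by (simp add: AE_all_countable)
  ultimately show ?thesis
    by eventually_elim (auto intro: summable_suminf_not_top)
qed

text \<open>Change of variables turns both sides into integrals of \<open>f\<close> against the
  common law. This reduces moments at any time to moments at time 0.\<close>

lemma integral_cong_distr:
  fixes f :: "'b \<Rightarrow> real"
  assumes [measurable]: "X \<in> measurable M N" "Y \<in> measurable M N" "f \<in> borel_measurable N"
    and "distr M N X = distr M N Y"
  shows "integrable M (\<lambda>x. f (X x)) = integrable M (\<lambda>x. f (Y x))"
    and "(\<integral>x. f (X x) \<partial>M) = (\<integral>x. f (Y x) \<partial>M)"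
proof -
  have "integrable (distr M N X) f = integrable M (\<lambda>x. f (X x))"
    "integrable (distr M N Y) f = integrable M (\<lambda>x. f (Y x))"
    by (rule integrable_distr_eq; measurable)+
  then show "integrable M (\<lambda>x. f (X x)) = integrable M (\<lambda>x. f (Y x))"
    unfolding assms(4) by blast
  have "integral\<^sup>L (distr M N X) f = (\<integral>x. f (X x) \<partial>M)"
    "integral\<^sup>L (distr M N Y) f = (\<integral>x. f (Y x) \<partial>M)"
    by (rule integral_distr; measurable)+
  then show "(\<integral>x. f (X x) \<partial>M) = (\<integral>x. f (Y x) \<partial>M)"
    unfolding assms(4) by (rule trans[OF sym])
qed

section \<open>Laws of whole paths and stationarity\<close>

lemma measurable_path:
  assumes "\<And>t. Y t \<in> borel_measurable M"
  shows "(\<lambda>\<omega> t. Y (t + h) \<omega>) \<in> measurable M (\<Pi>\<^sub>M t\<in>(UNIV :: int set). borel)"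
  using assms by (intro measurable_PiM_single') auto

text \<open>The case \<open>J = {0}\<close> with shift \<open>t\<close>, pushed forward along the
  only coordinate.\<close>

lemma strictly_stationary_marginal:
  assumes "strictly_stationary M Y"
  shows "distr M borel (Y t) = distr M borel (Y 0)"
proof -
  let ?P = "\<Pi>\<^sub>M t\<in>{0 :: int}. (borel :: real measure)"
  have [measurable]: "Y t \<in> borel_measurable M" for t
    using assms by (simp add: strictly_stationary_def)
  have "distr M borel (Y t) = distr (distr M ?P (\<lambda>\<omega>. \<lambda>s\<in>{0}. Y (s + t) \<omega>)) borel (\<lambda>x. x 0)"
    by (subst distr_distr) (auto simp: o_def)
  also have "\<dots> = distr (distr M ?P (\<lambda>\<omega>. \<lambda>s\<in>{0}. Y s \<omega>)) borel (\<lambda>x. x 0)"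
    using assms by (simp add: strictly_stationary_def)
  also have "\<dots> = distr M borel (Y 0)"
    by (subst distr_distr) (auto simp: o_def)
  finally show ?thesis .
qed

text \<open>Passes from finite-dimensional laws to the law of the whole path: cylinders are stable
  under intersection and generate the product sigma-algebra, so a finite measure is determined by
  its values on them.\<close>

lemma strictly_stationary_distr_path:
  assumes "prob_space M" and stat: "strictly_stationary M Y"
  shows "distr M (\<Pi>\<^sub>M t\<in>UNIV. borel) (\<lambda>\<omega> t. Y (t + h) \<omega>) =
    distr M (\<Pi>\<^sub>M t\<in>UNIV. borel) (\<lambda>\<omega> t. Y t \<omega>)"
proof -
  interpret prob_space M by fact
  have Y: "Y t \<in> borel_measurable M" for t
    using stat by (simp add: strictly_stationary_def)
  note path = measurable_path[of Y, OF Y]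
  \<comment> \<open>A cylinder over \<open>J\<close> constrains only the coordinates in
    \<open>J\<close>, so its probability is read off the finite-dimensional law. The shift
    \<open>k\<close> will be both \<open>h\<close> and 0.\<close>
  have cyl: "emeasure (distr M (\<Pi>\<^sub>M t\<in>UNIV. borel) (\<lambda>\<omega> t. Y (t + k) \<omega>))
        (prod_emb UNIV (\<lambda>_. borel) J (Pi\<^sub>E J A)) =
      emeasure (distr M (\<Pi>\<^sub>M t\<in>J. borel) (\<lambda>\<omega>. \<lambda>t\<in>J. Y (t + k) \<omega>)) (Pi\<^sub>E J A)"
    if "finite J" "\<And>i. i \<in> J \<Longrightarrow> A i \<in> sets borel" for k J A
  proof -
    have "(\<lambda>\<omega> t. Y (t + k) \<omega>) -` prod_emb UNIV (\<lambda>_. borel) J (Pi\<^sub>E J A) \<inter> space M =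
        (\<lambda>\<omega>. \<lambda>t\<in>J. Y (t + k) \<omega>) -` Pi\<^sub>E J A \<inter> space M"
      by (auto simp: prod_emb_def restrict_def)
    then show ?thesis
      using that Y path[of k]
      by (subst (1 2) emeasure_distr) (auto intro!: measurable_restrict sets_PiM_I sets_PiM_I_finite)
  qed
  show ?thesis
  proof (rule measure_eqI_PiM_infinite)
    show "finite_measure (distr M (\<Pi>\<^sub>M t\<in>UNIV. borel) (\<lambda>\<omega> t. Y (t + h) \<omega>))"
      using prob_space_distr[OF path[of h]] by (rule prob_space.finite_measure)
    fix A :: "int \<Rightarrow> real set" and J :: "int set"
    assume "finite J" "\<And>i. i \<in> J \<Longrightarrow> A i \<in> sets borel"
    with cyl[of J A h] cyl[of J A 0] stat
    show "emeasure (distr M (\<Pi>\<^sub>M t\<in>UNIV. borel) (\<lambda>\<omega> t. Y (t + h) \<omega>))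
        (prod_emb UNIV (\<lambda>_. borel) J (Pi\<^sub>E J A)) =
      emeasure (distr M (\<Pi>\<^sub>M t\<in>UNIV. borel) (\<lambda>\<omega> t. Y t \<omega>))
        (prod_emb UNIV (\<lambda>_. borel) J (Pi\<^sub>E J A))"
      by (simp add: strictly_stationary_def)
  qed simp_all
qed

text \<open>By independence the path law is a product measure, and since all factors equal
  \<open>D\<close>, relabelling the coordinates by a shift does not change it.\<close>

lemma iid_process_strictly_stationary:
  assumes "prob_space M" and iid: "iid_process M Y"
  shows "strictly_stationary M Y"
proof -
  interpret prob_space M by fact
  have Y: "Y t \<in> borel_measurable M" for t
    using iid by (simp add: iid_process_def indep_vars_def)
  define D where "D = distr M borel (Y 0)"
  interpret D: prob_space D
    unfolding D_def by (rule prob_space_distr[OF Y])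
  let ?U = "\<Pi>\<^sub>M t\<in>(UNIV :: int set). (borel :: real measure)"
  have path: "(\<lambda>\<omega> t. Y t \<omega>) \<in> measurable M ?U"
    using measurable_path[of Y M 0] Y by simp
  have "distr M ?U (\<lambda>\<omega>. \<lambda>t\<in>UNIV. Y t \<omega>) = (\<Pi>\<^sub>M t\<in>UNIV. distr M borel (Y t))"
    using iid Y by (subst indep_vars_iff_distr_eq_PiM[symmetric]) (auto simp: iid_process_def)
  moreover have "distr M borel (Y t) = D" for t
    using iid by (auto simp: iid_process_def D_def)
  ultimately have law: "distr M ?U (\<lambda>\<omega> t. Y t \<omega>) = (\<Pi>\<^sub>M t\<in>UNIV. D)"
    by (simp add: restrict_UNIV)
  have fdd: "distr M (\<Pi>\<^sub>M t\<in>J. borel) (\<lambda>\<omega>. \<lambda>t\<in>J. Y (t + h) \<omega>) = (\<Pi>\<^sub>M t\<in>J. D)"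
    for J :: "int set" and h
  proof -
    \<comment> \<open>The shift is moved from the process to a coordinate map on path space, where
      \<open>t + h\<close> is an injective reindexing of a product measure.\<close>
    have "distr M (\<Pi>\<^sub>M t\<in>J. borel) (\<lambda>\<omega>. \<lambda>t\<in>J. Y (t + h) \<omega>) =
        distr (distr M ?U (\<lambda>\<omega> t. Y t \<omega>)) (\<Pi>\<^sub>M t\<in>J. borel) (\<lambda>x. \<lambda>t\<in>J. x (t + h))"
      using path by (subst distr_distr) (auto simp: o_def intro!: measurable_restrict)
    also have "\<dots> = distr (\<Pi>\<^sub>M t\<in>UNIV. D) (\<Pi>\<^sub>M t\<in>J. D) (\<lambda>x. \<lambda>t\<in>J. x (t + h))"
      unfolding law by (intro distr_cong sets_PiM_cong) (auto simp: D_def)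
    also have "\<dots> = (\<Pi>\<^sub>M t\<in>J. D)"
      using distr_PiM_reindex[of UNIV "\<lambda>_. D" "\<lambda>t. t + h" J] D.prob_space_axioms
      by (auto simp: inj_on_def)
    finally show ?thesis .
  qed
  show ?thesis
    using Y fdd[of _ 0] fdd by (simp add: strictly_stationary_def)
qed

text \<open>Stationarity of each process alone does not control the pair; independence makes the
  joint law the product of the two path laws, each of which is shift invariant.\<close>

lemma distr_joint_path_shift:
  assumes "prob_space M" and statY: "strictly_stationary M Y" and statZ: "strictly_stationary M Z"
    and indep: "independent_processes M Y Z"
  defines "P \<equiv> (\<Pi>\<^sub>M t\<in>(UNIV :: int set). (borel :: real measure))"
  shows "distr M (P \<Otimes>\<^sub>M P) (\<lambda>\<omega>. (\<lambda>t. Y (t + h) \<omega>, \<lambda>t. Z (t + h) \<omega>)) =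
    distr M (P \<Otimes>\<^sub>M P) (\<lambda>\<omega>. (\<lambda>t. Y t \<omega>, \<lambda>t. Z t \<omega>))"
proof -
  interpret prob_space M by fact
  have shift: "(\<lambda>x t. x (t + h)) \<in> measurable P P"
    unfolding P_def by (intro measurable_path) simp
  have ind: "indep_var P (\<lambda>\<omega> t. Y t \<omega>) P (\<lambda>\<omega> t. Z t \<omega>)"
    using indep by (simp add: independent_processes_def P_def)
  \<comment> \<open>Shifting is a measurable map of path space, so applying it to both paths
    preserves independence.\<close>
  have "indep_var P (\<lambda>\<omega> t. Y (t + h) \<omega>) P (\<lambda>\<omega> t. Z (t + h) \<omega>)"
    using indep_var_compose[OF ind shift shift] by (simp add: o_def)
  then have "distr M (P \<Otimes>\<^sub>M P) (\<lambda>\<omega>. (\<lambda>t. Y (t + h) \<omega>, \<lambda>t. Z (t + h) \<omega>)) =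
      distr M P (\<lambda>\<omega> t. Y (t + h) \<omega>) \<Otimes>\<^sub>M distr M P (\<lambda>\<omega> t. Z (t + h) \<omega>)"
    by (simp add: indep_var_distribution_eq)
  also have "\<dots> = distr M P (\<lambda>\<omega> t. Y t \<omega>) \<Otimes>\<^sub>M distr M P (\<lambda>\<omega> t. Z t \<omega>)"
    unfolding P_def by (simp add: strictly_stationary_distr_path assms(1) statY statZ)
  also have "\<dots> = distr M (P \<Otimes>\<^sub>M P) (\<lambda>\<omega>. (\<lambda>t. Y t \<omega>, \<lambda>t. Z t \<omega>))"
    using ind by (simp add: indep_var_distribution_eq)
  finally show ?thesis .
qed

text \<open>Think of \<open>W h\<close> as the driving path shifted by \<open>h\<close>. The vector
  of shifted values of \<open>V\<close> is the image of \<open>W h\<close> under one map that does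
  not involve \<open>h\<close>, so its law inherits the invariance of the law of
  \<open>W h\<close>.\<close>

lemma strictly_stationary_functional:
  assumes path: "\<And>h. (\<lambda>\<omega>. W h \<omega>) \<in> measurable M N"
    and law: "\<And>h. distr M N (W h) = distr M N (W 0)"
    and F[measurable]: "\<And>t. F t \<in> borel_measurable N"
    and V: "\<And>t h \<omega>. V (t + h) \<omega> = F t (W h \<omega>)"
  shows "strictly_stationary M V"
proof -
  have [measurable]: "W h \<in> measurable M N" for h
    using path by simp
  have V0: "V t = (\<lambda>\<omega>. F t (W 0 \<omega>))" for t
    using V[of t 0] by auto
  have "distr M (\<Pi>\<^sub>M t\<in>J. borel) (\<lambda>\<omega>. \<lambda>t\<in>J. V (t + h) \<omega>) =
      distr (distr M N (W h)) (\<Pi>\<^sub>M t\<in>J. borel) (\<lambda>x. \<lambda>t\<in>J. F t x)" for J h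
    by (subst distr_distr) (auto simp: o_def V)
  from this[of _ 0] this have "distr M (\<Pi>\<^sub>M t\<in>J. borel) (\<lambda>\<omega>. \<lambda>t\<in>J. V (t + h) \<omega>) =
      distr M (\<Pi>\<^sub>M t\<in>J. borel) (\<lambda>\<omega>. \<lambda>t\<in>J. V t \<omega>)" for J h
    by (simp add: law[of h])
  moreover have "V t \<in> borel_measurable M" for t
    unfolding V0 by measurable
  ultimately show ?thesis
    by (simp add: strictly_stationary_def)
qed

section \<open>Moments of the summands\<close>

text \<open>Independence acts twice: between the squared innovations at distinct times, each
  contributing a factor \<open>\<alpha>1\<close>, and between their product and the liquidity term,
  whose mean is \<open>\<alpha>0 + l1\<close>.\<close>

lemma
  assumes "prob_space M" and iid: "iid_process M \<epsilon>"
    and int\<epsilon>: "integrable M (\<lambda>\<omega>. (\<epsilon> 0 \<omega>)\<^sup>2)" and E\<epsilon>: "(\<integral>\<omega>. (\<epsilon> 0 \<omega>)\<^sup>2 \<partial>M) = 1"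
    and stat: "strictly_stationary M L"
    and intL: "integrable M (L 0)" and EL: "(\<integral>\<omega>. L 0 \<omega> \<partial>M) = 1"
    and indep: "independent_processes M L \<epsilon>"
  shows integrable_arch_term: "integrable M (\<lambda>\<omega>. arch_term \<alpha>0 \<alpha>1 l1 \<epsilon> L t \<omega> i)" (is ?int)
    and integral_arch_term: "(\<integral>\<omega>. arch_term \<alpha>0 \<alpha>1 l1 \<epsilon> L t \<omega> i \<partial>M) = \<alpha>1 ^ i * (\<alpha>0 + l1)" (is ?eq)
proof -
  interpret prob_space M by fact
  have iv: "indep_vars (\<lambda>_. borel) \<epsilon> UNIV"
    using iid by (simp add: iid_process_def)
  have [measurable]: "\<epsilon> t \<in> borel_measurable M" for t
    using iv by (simp add: indep_vars_def)
  have [measurable]: "L t \<in> borel_measurable M" for t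
    using stat by (simp add: strictly_stationary_def)
  have dist\<epsilon>: "distr M borel (\<epsilon> s) = distr M borel (\<epsilon> 0)" for s
    using iid by (auto simp: iid_process_def)
  have A: "integrable M (arch_A \<alpha>1 \<epsilon> s)" "(\<integral>\<omega>. arch_A \<alpha>1 \<epsilon> s \<omega> \<partial>M) = \<alpha>1" for s
    using int\<epsilon> E\<epsilon> integral_cong_distr[of "\<epsilon> s" M borel "\<epsilon> 0" "\<lambda>x. x\<^sup>2", OF _ _ _ dist\<epsilon>]
    by (simp_all add: arch_A_def[abs_def])
  have distL: "distr M borel (L s) = distr M borel (L 0)" for s
    using stat by (rule strictly_stationary_marginal)
  have intLs: "integrable M (L s)" and ELs: "(\<integral>\<omega>. L s \<omega> \<partial>M) = 1" for s
  proof -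
    have Ls: "integrable M (L s) = integrable M (L 0)" "integral\<^sup>L M (L s) = integral\<^sup>L M (L 0)"
      by (rule integral_cong_distr[of "L s" M borel "L 0" "\<lambda>x. x", OF _ _ _ distL]; measurable)+
    show "integrable M (L s)" "(\<integral>\<omega>. L s \<omega> \<partial>M) = 1"
      unfolding Ls by (fact intL EL)+
  qed
  have B: "integrable M (arch_B \<alpha>0 l1 L s)" "(\<integral>\<omega>. arch_B \<alpha>0 l1 L s \<omega> \<partial>M) = \<alpha>0 + l1" for s
    unfolding arch_B_def[abs_def] using intLs by (simp_all add: ELs prob_space)
  let ?A = "\<lambda>s. arch_A \<alpha>1 \<epsilon> s"
  \<comment> \<open>The independent family is indexed by times, so the product over lags
    \<open>j\<close> is rewritten over the set of times \<open>t - j\<close>; injectivity gives it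
    exactly \<open>i\<close> elements.\<close>
  let ?T = "(\<lambda>j. t - int j) ` {..<i}"
  have inj: "inj_on (\<lambda>j. t - int j) {..<i}"
    by (auto simp: inj_on_def)
  have ivA: "indep_vars (\<lambda>_. borel) ?A ?T"
    unfolding arch_A_def[abs_def]
    by (rule indep_vars_compose2[where Y = "\<lambda>_ x. \<alpha>1 * x\<^sup>2", OF indep_vars_subset[OF iv]]) auto
  have prod: "(\<Prod>j<i. ?A (t - int j) \<omega>) = (\<Prod>s\<in>?T. ?A s \<omega>)" for \<omega>
    using inj by (simp add: prod.reindex)
  have PA: "integrable M (\<lambda>\<omega>. \<Prod>j<i. ?A (t - int j) \<omega>)"
    "(\<integral>\<omega>. (\<Prod>j<i. ?A (t - int j) \<omega>) \<partial>M) = \<alpha>1 ^ i"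
    unfolding prod using indep_vars_integrable[OF _ ivA A(1)] indep_vars_lebesgue_integral[OF _ ivA A(1)]
    by (simp_all add: A(2) card_image[OF inj])
  let ?P = "\<Pi>\<^sub>M t\<in>(UNIV :: int set). (borel :: real measure)"
  have "indep_var ?P (\<lambda>\<omega> t. L t \<omega>) ?P (\<lambda>\<omega> t. \<epsilon> t \<omega>)"
    using indep by (simp add: independent_processes_def)
  \<comment> \<open>One factor is a functional of the path of \<open>L\<close> only, the other of
    the path of \<open>\<epsilon>\<close> only.\<close>
  then have "indep_var borel ((\<lambda>x. \<alpha>0 + l1 * x (t - int i)) \<circ> (\<lambda>\<omega> t. L t \<omega>))
      borel ((\<lambda>x. \<Prod>j<i. \<alpha>1 * (x (t - int j))\<^sup>2) \<circ> (\<lambda>\<omega> t. \<epsilon> t \<omega>))"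
    by (rule indep_var_compose) measurable
  then have ind: "indep_var borel (arch_B \<alpha>0 l1 L (t - int i)) borel (\<lambda>\<omega>. \<Prod>j<i. ?A (t - int j) \<omega>)"
    by (simp add: o_def arch_A_def arch_B_def[abs_def])
  show ?int ?eq
    unfolding arch_term_def
    using indep_var_integrable[OF ind B(1) PA(1)] indep_var_lebesgue_integral[OF ind B(1) PA(1)]
    by (simp_all add: PA(2) B(2) mult.commute)
qed

section \<open>Convergence, recurrence and stationarity of the series\<close>

theorem theorem2p2:
  fixes M :: "'a measure"
    and \<epsilon> L V :: "int \<Rightarrow> 'a \<Rightarrow> real"
    and \<alpha>0 \<alpha>1 l1 :: real
  assumes "prob_space M"
    and "iid_process M \<epsilon>"
    and "integrable M (\<epsilon> 0)" and "(\<integral>\<omega>. \<epsilon> 0 \<omega> \<partial>M) = 0"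
    and "integrable M (\<lambda>\<omega>. (\<epsilon> 0 \<omega>)\<^sup>2)" and "(\<integral>\<omega>. (\<epsilon> 0 \<omega>)\<^sup>2 \<partial>M) = 1"
    and "strictly_stationary M L"
    and "\<And>t. AE \<omega> in M. 0 < L t \<omega>"
    and "integrable M (L 0)" and "(\<integral>\<omega>. L 0 \<omega> \<partial>M) = 1"
    and "independent_processes M L \<epsilon>"
    and "0 \<le> \<alpha>0" and "0 < \<alpha>1" and "0 < l1"
    and "integrable M (\<lambda>\<omega>. (L 0 \<omega>)\<^sup>2)"
    and "\<alpha>1 < 1"
    and V: "\<And>t \<omega>. V (t + 1) \<omega> = (\<Sum>i. arch_term \<alpha>0 \<alpha>1 l1 \<epsilon> L t \<omega> i)"
  shows "(\<forall>t. AE \<omega> in M. summable (arch_term \<alpha>0 \<alpha>1 l1 \<epsilon> L t \<omega>)) \<and>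
    arch_recurrence_solution M \<alpha>0 \<alpha>1 l1 \<epsilon> L V \<and>
    arch_model_solution M \<alpha>0 \<alpha>1 l1 \<epsilon> L
      (\<lambda>t \<omega>. sqrt (V t \<omega>) * \<epsilon> t \<omega>) (\<lambda>t \<omega>. sqrt (V t \<omega>)) \<and>
    strictly_stationary M V"
proof -
  interpret prob_space M by fact
  let ?term = "arch_term \<alpha>0 \<alpha>1 l1 \<epsilon> L"
  have stat\<epsilon>: "strictly_stationary M \<epsilon>"
    using assms(1,2) by (rule iid_process_strictly_stationary)
  have \<epsilon>[measurable]: "\<epsilon> t \<in> borel_measurable M" for t
    using stat\<epsilon> by (simp add: strictly_stationary_def)
  have L[measurable]: "L t \<in> borel_measurable M" for t
    using assms(7) by (simp add: strictly_stationary_def)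
  \<comment> \<open>Off by one: \<open>V t\<close> is the series started at
    \<open>t - 1\<close>.\<close>
  have V': "V t \<omega> = (\<Sum>i. ?term (t - 1) \<omega> i)" for t \<omega>
    using V[of "t - 1"] by simp
  \<comment> \<open>This includes points where the series diverges: there \<open>suminf\<close>
    returns one fixed unspecified value.\<close>
  have V_meas[measurable]: "V t \<in> borel_measurable M" for t
    unfolding V'[abs_def] by (intro borel_measurable_suminf measurable_arch_term \<epsilon> L)

  have "AE \<omega> in M. 0 \<le> L t \<omega>" for t
    using assms(8)[of t] by eventually_elim simp
  \<comment> \<open>Each summand involves a different time of \<open>L\<close>; as
    \<open>int\<close> is countable, one null set serves all times.\<close>
  then have "AE \<omega> in M. \<forall>t. 0 \<le> L t \<omega>"
    by (simp add: AE_all_countable)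
  then have term_nonneg: "AE \<omega> in M. \<forall>t i. 0 \<le> ?term t \<omega> i"
    by eventually_elim (use assms(12-14) in \<open>simp add: arch_term_nonneg\<close>)
  have summ: "AE \<omega> in M. summable (?term t \<omega>)" for t
  proof (rule AE_summable_of_integral)
    show "AE \<omega> in M. 0 \<le> ?term t \<omega> i" for i
      using term_nonneg by eventually_elim simp
    \<comment> \<open>The expectations form a geometric series with ratio \<open>\<alpha>1\<close>;
      this is where \<open>\<alpha>1 < 1\<close> enters.\<close>
    show "summable (\<lambda>i. \<integral>\<omega>. ?term t \<omega> i \<partial>M)"
      using assms(13,16) by (simp add: integral_arch_term[OF assms(1,2,5-7,9-11)] summable_mult2)
  qed (rule integrable_arch_term[OF assms(1,2,5-7,9-11)])

  have V_nonneg: "AE \<omega> in M. 0 \<le> V t \<omega>" for t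
    using term_nonneg summ[of "t - 1"] by eventually_elim (simp add: V' suminf_nonneg)
  have V_rec: "AE \<omega> in M. V (t + 1) \<omega> = arch_A \<alpha>1 \<epsilon> t \<omega> * V t \<omega> + arch_B \<alpha>0 l1 L t \<omega>" for t
    using summ[of t] summ[of "t - 1"]
    by eventually_elim (simp add: V V'[of t] suminf_arch_term_rec)
  have rec: "arch_recurrence_solution M \<alpha>0 \<alpha>1 l1 \<epsilon> L V"
    using V_nonneg V_rec by (simp add: arch_recurrence_solution_def)

  \<comment> \<open>The recurrence at \<open>t - 1\<close>, with nonnegativity of \<open>V\<close>
    at \<open>t\<close> and \<open>t - 1\<close> used to cancel square and square root.\<close>
  have model_eq: "AE \<omega> in M. (sqrt (V t \<omega>))\<^sup>2 =
      \<alpha>0 + \<alpha>1 * (sqrt (V (t - 1) \<omega>) * \<epsilon> (t - 1) \<omega>)\<^sup>2 + l1 * L (t - 1) \<omega>" for t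
    using V_nonneg[of t] V_nonneg[of "t - 1"] V_rec[of "t - 1"]
    by eventually_elim (simp add: arch_A_def arch_B_def power_mult_distrib)
  have "AE \<omega> in M. 0 \<le> sqrt (V t \<omega>)" for t
    using V_nonneg[of t] by eventually_elim simp
  with model_eq have model: "arch_model_solution M \<alpha>0 \<alpha>1 l1 \<epsilon> L
      (\<lambda>t \<omega>. sqrt (V t \<omega>) * \<epsilon> t \<omega>) (\<lambda>t \<omega>. sqrt (V t \<omega>))"
    by (simp add: arch_model_solution_def)

  let ?P = "\<Pi>\<^sub>M t\<in>(UNIV :: int set). (borel :: real measure)"
  have "strictly_stationary M V"
  \<comment> \<open>The sample space is replaced by pairs of paths, with \<open>fst\<close> carrying
    the liquidity and \<open>snd\<close> the innovations as coordinate processes. The series built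
    from these coordinates is the functional \<open>F t\<close>.\<close>
  proof (rule strictly_stationary_functional[where N = "?P \<Otimes>\<^sub>M ?P"
        and W = "\<lambda>h \<omega>. (\<lambda>t. L (t + h) \<omega>, \<lambda>t. \<epsilon> (t + h) \<omega>)"
        and F = "\<lambda>t x. \<Sum>i. arch_term \<alpha>0 \<alpha>1 l1 (\<lambda>s x. snd x s) (\<lambda>s x. fst x s) (t - 1) x i"])
    show "(\<lambda>\<omega>. (\<lambda>t. L (t + h) \<omega>, \<lambda>t. \<epsilon> (t + h) \<omega>)) \<in> measurable M (?P \<Otimes>\<^sub>M ?P)" for h
      by (intro measurable_Pair measurable_path L \<epsilon>)
    show "distr M (?P \<Otimes>\<^sub>M ?P) (\<lambda>\<omega>. (\<lambda>t. L (t + h) \<omega>, \<lambda>t. \<epsilon> (t + h) \<omega>)) =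
        distr M (?P \<Otimes>\<^sub>M ?P) (\<lambda>\<omega>. (\<lambda>t. L (t + 0) \<omega>, \<lambda>t. \<epsilon> (t + 0) \<omega>))" for h
      using distr_joint_path_shift[OF assms(1,7) stat\<epsilon> assms(11)] by simp
    show "(\<lambda>x. \<Sum>i. arch_term \<alpha>0 \<alpha>1 l1 (\<lambda>s x. snd x s) (\<lambda>s x. fst x s) (t - 1) x i)
        \<in> borel_measurable (?P \<Otimes>\<^sub>M ?P)" for t
      by (intro borel_measurable_suminf measurable_arch_term) measurable
    \<comment> \<open>The two series agree summand by summand, so the identity holds at every point,
      convergent or not.\<close>
    show "V (t + h) \<omega> = (\<Sum>i. arch_term \<alpha>0 \<alpha>1 l1 (\<lambda>s x. snd x s) (\<lambda>s x. fst x s) (t - 1)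
        (\<lambda>t. L (t + h) \<omega>, \<lambda>t. \<epsilon> (t + h) \<omega>) i)" for t h \<omega>
      by (simp add: V' arch_term_def arch_A_def arch_B_def algebra_simps)
  qed
  with summ rec model show ?thesis
    by blast
qed

end
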